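(* Let $n\ge 1$, let $X_1,\dots,X_n$ be independent real random variables, and let $S:\mathbb{R}^n\to\mathbb{R}$ be a Borel function with $\mathbb{E}\,S^2(X_1,\dots,X_n)<+\infty$; write $S$ for $S(X_1,\dots,X_n)$. Let $J_k$ and $K_k$ ($k\ge1$) be the quantities associated with $S$ defined in the context. Then for every $p=1,2,\dots,[n/2]$ (where $[\cdot]$ denotes integer part), $$\sum_{k=1}^{2p}\frac{(-1)^{k+1}}{k!}\,\mathbb{E}J_k+\frac{1}{(2p+1)!}\,\mathbb{E}K_{2p+1}\;\le\;\operatorname{Var} S\;\le\;\sum_{k=1}^{2p-1}\frac{(-1)^{k+1}}{k!}\,\mathbb{E}J_k-\frac{1}{(2p)!}\,\mathbb{E}K_{2p}.$$
   Context: The $X_i$ are not assumed identically distributed and $S$ is not assumed symmetric. Let $\mu_i$ be the law of $X_i$. In what follows $Y$ denotes any square-integrable random variable of the form $Y=g(X_1,\dots,X_n)$ with $g$ Borel. For $i\in\{1,\dots,n\}$, $\mathbb{E}^{(i)}$ is conditional expectation given $X_1,\dots,X_{i-1},X_{i+1},\dots,X_n$, i.e. $$\mathbb{E}^{(i)}Y=\int g(X_1,\dots,X_{i-1},x_i,X_{i+1},\dots,X_n)\,\mu_i(dx_i).$$ These operators commute, and $\mathbb{E}^{(i_1,\dots,i_k)}:=\mathbb{E}^{(i_1)}\cdots\mathbb{E}^{(i_k)}$ (the identity operator if the list of indices is empty). Iterated conditional variances: $\operatorname{Var}^{(i)}Y:=\mathbb{E}^{(i)}(Y-\mathbb{E}^{(i)}Y)^2=\mathbb{E}^{(i)}Y^2-(\mathbb{E}^{(i)}Y)^2$,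 and recursively, for distinct indices $i_1,\dots,i_k\in\{1,\dots,n\}$, $k\ge2$, $$\operatorname{Var}^{(i_1,\dots,i_k)}Y:=\mathbb{E}^{(i_1)}\big(\operatorname{Var}^{(i_2,\dots,i_k)}Y\big)-\operatorname{Var}^{(i_2,\dots,i_k)}\big(\mathbb{E}^{(i_1)}Y\big).$$ The result does not depend on the order of the indices. (For $k\ge2$ this is not the usual conditional variance.) For $k\ge1$, $$J_k:=k!\sum_{1\le i_1<\cdots<i_k\le n}\operatorname{Var}^{(i_1,\dots,i_k)}S,\qquad K_k:=k!\sum_{1\le i_1<\cdots<i_k\le n}\operatorname{Var}^{(i_1,\dots,i_k)}\big(\mathbb{E}^{\overline{(i_1,\dots,i_k)}}S\big),$$ where $\overline{(i_1,\dots,i_k)}$ is the ordered sequence of the elements of $\{1,\dots,n\}\setminus\{i_1,\dots,i_k\}$. An empty sum is $0$; in particular $K_{n+1}=0$ (this occurs when $2p=n$). *)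

theory Defs
  imports "HOL-Probability.Probability"
begin

(* A random variable g(X_1,...,X_n) is represented by the function g itself, a real function on
   the space of the product measure of the laws \<mu> 1, ..., \<mu> n, whose points are the
   vectors x : nat => real that are undefined outside {1..n}.  The operators below act on g; the
   random variable is recovered by evaluating at the vector (X_1,...,X_n).

   Where g(x(i := _)) is not integrable, the Bochner integral below is 0.  For integrable
   g(X_1,...,X_n) this concerns a null set only; lemma real_cond_exp_eq_cond_exp_coord shows that
   the formula then is a version of the library's conditional expectation. *)

definition cond_exp_coord ::
  "(nat \<Rightarrow> real measure) \<Rightarrow> nat \<Rightarrow> ((nat \<Rightarrow> real) \<Rightarrow> real) \<Rightarrow> (nat \<Rightarrow> real) \<Rightarrow> real" where
  "cond_exp_coord \<mu> i g = (\<lambda>x. \<integral>t. g (x(i := t)) \<partial>\<mu> i)"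

definition cond_exp_coords ::
  "(nat \<Rightarrow> real measure) \<Rightarrow> nat list \<Rightarrow> ((nat \<Rightarrow> real) \<Rightarrow> real) \<Rightarrow> (nat \<Rightarrow> real) \<Rightarrow> real" where
  "cond_exp_coords \<mu> is g = foldr (cond_exp_coord \<mu>) is g"

(* Deliberately no equation for the empty list, for which there is no iterated variance. *)
fun iter_var ::
  "(nat \<Rightarrow> real measure) \<Rightarrow> nat list \<Rightarrow> ((nat \<Rightarrow> real) \<Rightarrow> real) \<Rightarrow> (nat \<Rightarrow> real) \<Rightarrow> real" where
  "iter_var \<mu> [i] g = cond_exp_coord \<mu> i (\<lambda>x. (g x - cond_exp_coord \<mu> i g x)\<^sup>2)"
| "iter_var \<mu> (i # j # js) g =
    (\<lambda>x. cond_exp_coord \<mu> i (iter_var \<mu> (j # js) g) x - iter_var \<mu> (j # js) (cond_exp_coord \<mu> i g) x)"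

(* Index tuples i_1 < ... < i_k in {1..n} are the sorted lists of the k-element subsets. *)
definition J_stat ::
  "(nat \<Rightarrow> real measure) \<Rightarrow> nat \<Rightarrow> ((nat \<Rightarrow> real) \<Rightarrow> real) \<Rightarrow> nat \<Rightarrow> (nat \<Rightarrow> real) \<Rightarrow> real" where
  "J_stat \<mu> n S k = (\<lambda>x. fact k *
     (\<Sum>A | A \<subseteq> {1..n} \<and> card A = k. iter_var \<mu> (sorted_list_of_set A) S x))"

definition K_stat ::
  "(nat \<Rightarrow> real measure) \<Rightarrow> nat \<Rightarrow> ((nat \<Rightarrow> real) \<Rightarrow> real) \<Rightarrow> nat \<Rightarrow> (nat \<Rightarrow> real) \<Rightarrow> real" where
  "K_stat \<mu> n S k = (\<lambda>x. fact k *
     (\<Sum>A | A \<subseteq> {1..n} \<and> card A = k.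
        iter_var \<mu> (sorted_list_of_set A)
          (cond_exp_coords \<mu> (sorted_list_of_set ({1..n} - A)) S) x))"

lemma real_cond_exp_eq_cond_exp_coord:
  fixes M :: "'a measure" and X :: "nat \<Rightarrow> 'a \<Rightarrow> real" and g :: "(nat \<Rightarrow> real) \<Rightarrow> real"
  defines "\<mu> \<equiv> \<lambda>i. distr M borel (X i)"
  assumes M: "prob_space M"
    and ind: "prob_space.indep_vars M (\<lambda>_. borel) X {1..n}"
    and g[measurable]: "g \<in> borel_measurable (Pi\<^sub>M {1..n} (\<lambda>_. borel))"
    and int: "integrable M (\<lambda>\<omega>. g (\<lambda>j\<in>{1..n}. X j \<omega>))"
    and i: "i \<in> {1..n}"
  shows "AE \<omega> in M.
    real_cond_exp M
      (vimage_algebra (space M) (\<lambda>\<omega>. \<lambda>j\<in>{1..n} - {i}. X j \<omega>) (Pi\<^sub>M ({1..n} - {i}) (\<lambda>_. borel)))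
      (\<lambda>\<omega>. g (\<lambda>j\<in>{1..n}. X j \<omega>)) \<omega>
    = cond_exp_coord \<mu> i g (\<lambda>j\<in>{1..n}. X j \<omega>)"
proof -
  interpret prob_space M by fact
  define I where "I = {1..n}"
  define J where "J = I - {i}"
  have IJ: "I = insert i J" "i \<notin> J" "finite I" "finite J" "i \<in> I"
    using i by (auto simp: I_def J_def)
  define N where "N = (\<lambda>j. if j \<in> I then \<mu> j else return borel 0)"
  have X[measurable]: "X j \<in> borel_measurable M" if "j \<in> I" for j
    using ind that unfolding indep_vars_def I_def by auto
  have N: "prob_space (N j)" "sets (N j) = sets borel" for j
    by (auto simp: N_def \<mu>_def intro!: prob_space_distr prob_space_return)
  interpret PP: product_prob_space N I
    by (rule product_prob_spaceI) (rule N)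
  define V where "V = (\<lambda>\<omega>. \<lambda>j\<in>I. X j \<omega>)"
  define W where "W = (\<lambda>\<omega>. \<lambda>j\<in>J. X j \<omega>)"
  have setsN: "sets (Pi\<^sub>M K N) = sets (Pi\<^sub>M K (\<lambda>_. borel))" for K
    by (intro sets_PiM_cong) (auto simp: N)
  have V[measurable]: "V \<in> measurable M (Pi\<^sub>M I (\<lambda>_. borel))"
    unfolding V_def by measurable
  have W[measurable]: "W \<in> measurable M (Pi\<^sub>M J (\<lambda>_. borel))"
    unfolding W_def by (rule measurable_restrict) (use IJ in auto)
  have WV: "W \<omega> = restrict (V \<omega>) J" for \<omega>
    using IJ by (auto simp: W_def V_def fun_eq_iff)
  have V_app: "V \<omega> = (\<lambda>j\<in>I. X j \<omega>)" for \<omega>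
    by (simp add: V_def)
  have dV: "distr M (Pi\<^sub>M I (\<lambda>_. borel)) V = Pi\<^sub>M I N"
  proof -
    have "distr M (Pi\<^sub>M I (\<lambda>_. borel)) V = Pi\<^sub>M I (\<lambda>i. distr M borel (X i))"
      unfolding V_def by (rule indep_vars_iff_distr_eq_PiM'[THEN iffD1]) (use IJ ind in \<open>auto simp: I_def X\<close>)
    also have "\<dots> = Pi\<^sub>M I N"
      by (intro PiM_cong) (auto simp: N_def \<mu>_def)
    finally show ?thesis .
  qed
  have dW: "distr M (Pi\<^sub>M J (\<lambda>_. borel)) W = Pi\<^sub>M J N"
  proof -
    have "Pi\<^sub>M J N = distr (Pi\<^sub>M I N) (Pi\<^sub>M J N) (\<lambda>f. restrict f J)"
      by (rule PP.distr_restrict) (use IJ in auto)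
    also have "\<dots> = distr (distr M (Pi\<^sub>M I (\<lambda>_. borel)) V) (Pi\<^sub>M J (\<lambda>_. borel)) (\<lambda>f. restrict f J)"
      unfolding dV by (rule distr_cong) (auto simp: setsN)
    also have "\<dots> = distr M (Pi\<^sub>M J (\<lambda>_. borel)) ((\<lambda>f. restrict f J) \<circ> V)"
      by (intro distr_distr measurable_restrict_subset V) (use IJ in auto)
    also have "(\<lambda>f. restrict f J) \<circ> V = W"
      by (auto simp: WV)
    finally show ?thesis by simp
  qed
  define c where "c = (\<lambda>x. \<integral>t. g (x(i := t)) \<partial>N i)"
  have gN[measurable]: "g \<in> borel_measurable (Pi\<^sub>M I N)"
    using g measurable_cong_sets[OF setsN[of I] refl] by (auto simp: I_def)
  have gint: "integrable (Pi\<^sub>M I N) g"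
    unfolding dV[symmetric] using int g unfolding I_def[symmetric] by (simp add: integrable_distr_eq V V_app)
  have upd: "(\<lambda>(x, t). x(i := t)) \<in> measurable (Pi\<^sub>M J N \<Otimes>\<^sub>M N i) (Pi\<^sub>M I N)"
    unfolding IJ(1) by (rule measurable_add_dim)
  have ug: "(\<lambda>(x, t). g (x(i := t))) \<in> borel_measurable (Pi\<^sub>M J N \<Otimes>\<^sub>M N i)"
    using measurable_compose[OF upd gN] by (simp add: case_prod_beta')
  have cm: "c \<in> borel_measurable (Pi\<^sub>M J N)"
    unfolding c_def by (rule sigma_finite_measure.borel_measurable_lebesgue_integral[OF prob_space_imp_sigma_finite[OF N(1)] ug])
  have cmb[measurable]: "c \<in> borel_measurable (Pi\<^sub>M J (\<lambda>_. borel))"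
    using cm measurable_cong_sets[OF setsN[of J] refl] by auto
  have norm_c: "ennreal (norm (c x)) \<le> (\<integral>\<^sup>+t. ennreal (norm (g (x(i := t)))) \<partial>N i)" for x
    by (cases "integrable (N i) (\<lambda>t. g (x(i := t)))")
       (simp_all add: c_def integral_norm_bound_ennreal not_integrable_integral_eq del: real_norm_def)
  have cint: "integrable (Pi\<^sub>M J N) c"
  proof (rule integrableI_bounded[OF cm])
    have "(\<integral>\<^sup>+x. ennreal (norm (c x)) \<partial>Pi\<^sub>M J N)
        \<le> (\<integral>\<^sup>+x. (\<integral>\<^sup>+t. ennreal (norm (g (x(i := t)))) \<partial>N i) \<partial>Pi\<^sub>M J N)"
      by (intro nn_integral_mono norm_c)
    also have "\<dots> = (\<integral>\<^sup>+x. ennreal (norm (g x)) \<partial>Pi\<^sub>M I N)"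
      unfolding IJ(1)
      by (rule PP.product_nn_integral_insert[symmetric]) (use IJ in \<open>auto simp flip: IJ(1)\<close>)
    also have "\<dots> < \<infinity>"
      using gint by (simp add: integrable_iff_bounded)
    finally show "(\<integral>\<^sup>+x. ennreal (norm (c x)) \<partial>Pi\<^sub>M J N) < \<infinity>" .
  qed
  have cW: "cond_exp_coord \<mu> i g (V \<omega>) = c (W \<omega>)" for \<omega>
  proof -
    have "(V \<omega>)(i := t) = (W \<omega>)(i := t)" for t
      using IJ by (auto simp: V_def W_def fun_eq_iff)
    then show ?thesis
      using IJ by (simp add: cond_exp_coord_def c_def N_def)
  qed
  define F where "F = vimage_algebra (space M) W (Pi\<^sub>M J (\<lambda>_. borel))"
  have W_space: "W \<in> space M \<rightarrow> space (Pi\<^sub>M J (\<lambda>_. borel))"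
    using measurable_space[OF W] by blast
  have sub: "subalgebra M F"
    unfolding subalgebra_def F_def sets_vimage_algebra2[OF W_space] using measurable_sets[OF W] by auto
  interpret F: sigma_finite_subalgebra M F
    by (rule finite_measure_subalgebra_is_sigma_finite)
       (use sub in \<open>auto simp: finite_measure_subalgebra_def finite_measure_subalgebra_axioms_def finite_measure_axioms\<close>)
  have WF: "W \<in> measurable F (Pi\<^sub>M J (\<lambda>_. borel))"
    unfolding F_def by (rule measurable_vimage_algebra1[OF W_space])
  have "AE \<omega> in M. real_cond_exp M F (\<lambda>\<omega>. g (V \<omega>)) \<omega> = c (W \<omega>)"
  proof (rule F.real_cond_exp_charact)
    show "integrable M (\<lambda>\<omega>. g (V \<omega>))"
      using int by (simp add: V_def I_def)
    show "integrable M (\<lambda>\<omega>. c (W \<omega>))"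
      using cint unfolding dW[symmetric] by (simp add: integrable_distr_eq)
    show "(\<lambda>\<omega>. c (W \<omega>)) \<in> borel_measurable F"
      using measurable_compose[OF WF cmb] .
    fix A assume "A \<in> sets F"
    then obtain B where B: "B \<in> sets (Pi\<^sub>M J (\<lambda>_. borel))" "A = W -` B \<inter> space M"
      unfolding F_def sets_vimage_algebra2[OF W_space] by auto
    have ind: "indicator A \<omega> = (indicator B (restrict (V \<omega>) J) :: real)" if "\<omega> \<in> space M" for \<omega>
      using that B by (auto simp: WV indicator_def)
    have [measurable]: "B \<in> sets (Pi\<^sub>M J (\<lambda>_. borel))" by fact
    have rm[measurable]: "(\<lambda>x. restrict x J) \<in> measurable (Pi\<^sub>M I (\<lambda>_. borel)) (Pi\<^sub>M J (\<lambda>_. borel))"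
      by (rule measurable_restrict_subset) (use IJ in auto)
    have gb[measurable]: "g \<in> borel_measurable (Pi\<^sub>M I (\<lambda>_. borel))"
      using g by (simp add: I_def)
    have mb: "(\<lambda>x. indicator B (restrict x J) * g x) \<in> borel_measurable (Pi\<^sub>M I (\<lambda>_. borel))"
      by measurable
    then have mbN: "(\<lambda>x. indicator B (restrict x J) * g x) \<in> borel_measurable (Pi\<^sub>M I N)"
      unfolding measurable_cong_sets[OF setsN refl] .
    have Bint: "integrable (Pi\<^sub>M (insert i J) N) (\<lambda>x. indicator B (restrict x J) * g x)"
      unfolding IJ(1)[symmetric]
      by (rule Bochner_Integration.integrable_bound[OF gint mbN]) (auto simp: indicator_def)
    have "(\<integral>\<omega>\<in>A. g (V \<omega>) \<partial>M) = (\<integral>\<omega>. indicator B (restrict (V \<omega>) J) * g (V \<omega>) \<partial>M)"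
      unfolding set_lebesgue_integral_def by (intro Bochner_Integration.integral_cong) (auto simp: ind)
    also have "\<dots> = (\<integral>x. indicator B (restrict x J) * g x \<partial>Pi\<^sub>M I N)"
      unfolding dV[symmetric] by (rule integral_distr[symmetric, OF V mb])
    also have "\<dots> = (\<integral>x. (\<integral>t. indicator B (restrict (x(i := t)) J) * g (x(i := t)) \<partial>N i) \<partial>Pi\<^sub>M J N)"
      unfolding IJ(1) by (rule PP.product_integral_insert) (use IJ Bint in auto)
    also have "\<dots> = (\<integral>x. indicator B x * c x \<partial>Pi\<^sub>M J N)"
    proof (rule Bochner_Integration.integral_cong[OF refl])
      fix x assume "x \<in> space (Pi\<^sub>M J N)"
      then have "restrict (x(i := t)) J = x" for t
        using IJ(2) by (auto simp: space_PiM PiE_def extensional_def fun_eq_iff restrict_def)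
      then show "(\<integral>t. indicator B (restrict (x(i := t)) J) * g (x(i := t)) \<partial>N i) = indicator B x * c x"
        by (simp add: c_def)
    qed
    also have "\<dots> = (\<integral>\<omega>. indicator B (W \<omega>) * c (W \<omega>) \<partial>M)"
      unfolding dW[symmetric] by (rule integral_distr[OF W]) measurable
    also have "\<dots> = (\<integral>\<omega>\<in>A. c (W \<omega>) \<partial>M)"
      unfolding set_lebesgue_integral_def by (intro Bochner_Integration.integral_cong) (auto simp: ind WV)
    finally show "(\<integral>\<omega>\<in>A. g (V \<omega>) \<partial>M) = (\<integral>\<omega>\<in>A. c (W \<omega>) \<partial>M)" .
  qed
  then show ?thesis
    unfolding cW[symmetric] by (simp add: F_def V_def W_def I_def J_def)
qed

end

theory Submission
  imports Defs
begin

text \<open>Let \<open>E i\<close> be the conditional expectation that integrates out coordinate \<open>i\<close>, and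
  \<open>D i = 1 - E i\<close>. On square-integrable functions these operators commute up to null sets, and
  \<open>\<parallel>D i Y\<parallel>\<^sup>2 = \<parallel>Y\<parallel>\<^sup>2 - \<parallel>E i Y\<parallel>\<^sup>2\<close>. The recursion for the iterated variances therefore
  gives that the expectation of \<open>Var\<close> over the index set \<open>A\<close> of \<open>Y\<close> is the squared norm of
  \<open>D\<close> over \<open>A\<close> applied to \<open>Y\<close>. Put \<open>\<sigma> B\<close> for the squared norm of
  \<open>(\<Prod>i\<in>B. D i) (\<Prod>i\<notin>B. E i) S\<close>, the Hoeffding component of \<open>S\<close> at \<open>B\<close>. Splitting each free
  coordinate into its \<open>D\<close> and \<open>E\<close> part shows that the variance of \<open>S\<close> is the sum of \<open>\<sigma> B\<close> over nonempty \<open>B\<close>,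
  while \<open>J\<^sub>k / k!\<close> and \<open>K\<^sub>k / k!\<close> have expectations \<open>\<Sum>B. (card B choose k) * \<sigma> B\<close> and
  \<open>\<Sum>card B = k. \<sigma> B\<close>. The bounds then follow, coefficient by coefficient, from
  \<open>(\<Sum>k=1..m. (-1)^(k+1) * (b choose k)) = 1 - (-1)^m * (b - 1 choose m)\<close> for \<open>b \<ge> 1\<close>.\<close>

section \<open>Alternating sums over subsets\<close>

text \<open>Pascal's rule writes \<open>b choose k\<close> as a sum of two neighbouring coefficients
  of \<open>b - 1\<close>, so the alternating sum telescopes to its two boundary terms.\<close>

lemma alternating_binomial_partial_sum:
  fixes b m :: nat
  assumes "b \<ge> 1"
  shows "(\<Sum>k=1..m. (-1) ^ (k+1) * real (b choose k)) = 1 - (-1) ^ m * real ((b - 1) choose m)"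
proof (induction m)
  case (Suc m)
  obtain c where "b = Suc c" using assms by (cases b) auto
  then show ?case using Suc by (simp add: algebra_simps)
qed simp

text \<open>After exchanging the sums, each \<open>B\<close> is counted once for every
  \<open>k\<close>-element subset \<open>A\<close> of it.\<close>

lemma sum_supersets:
  fixes \<sigma> :: "'i set \<Rightarrow> real"
  assumes fin: "finite I"
  shows "(\<Sum>A | A \<subseteq> I \<and> card A = k. \<Sum>B | A \<subseteq> B \<and> B \<subseteq> I. \<sigma> B) = (\<Sum>B\<in>Pow I. real (card B choose k) * \<sigma> B)"
proof -
  have "(\<Sum>A | A \<subseteq> I \<and> card A = k. \<Sum>B | A \<subseteq> B \<and> B \<subseteq> I. \<sigma> B)
      = (\<Sum>A\<in>{A. A \<subseteq> I \<and> card A = k}. \<Sum>B\<in>{B. B \<in> Pow I \<and> A \<subseteq> B}. \<sigma> B)"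
    by (intro sum.cong) auto
  also have "\<dots> = (\<Sum>B\<in>Pow I. \<Sum>A\<in>{A. A \<in> {A. A \<subseteq> I \<and> card A = k} \<and> A \<subseteq> B}. \<sigma> B)"
    using fin by (intro sum.swap_restrict) auto
  also have "\<dots> = (\<Sum>B\<in>Pow I. real (card B choose k) * \<sigma> B)"
  proof (rule sum.cong[OF refl])
    fix B assume "B \<in> Pow I"
    then have "{A. A \<in> {A. A \<subseteq> I \<and> card A = k} \<and> A \<subseteq> B} = {A. A \<subseteq> B \<and> card A = k}"
      "finite B"
      using fin finite_subset by auto
    then show "(\<Sum>A\<in>{A. A \<in> {A. A \<subseteq> I \<and> card A = k} \<and> A \<subseteq> B}. \<sigma> B) = real (card B choose k) * \<sigma> B"
      by (simp add: n_subsets)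
  qed
  finally show ?thesis .
qed

lemma alternating_subset_sum:
  fixes \<sigma> :: "'i set \<Rightarrow> real"
  assumes fin: "finite I"
  shows "(\<Sum>k=1..m. (-1) ^ (k+1) * (\<Sum>B\<in>Pow I. real (card B choose k) * \<sigma> B)) =
    (\<Sum>B\<in>Pow I - {{}}. \<sigma> B - (-1) ^ m * real ((card B - 1) choose m) * \<sigma> B)"
proof -
  have "(\<Sum>k=1..m. (-1) ^ (k+1) * (\<Sum>B\<in>Pow I. real (card B choose k) * \<sigma> B)) =
      (\<Sum>B\<in>Pow I. \<Sum>k=1..m. (-1) ^ (k+1) * real (card B choose k) * \<sigma> B)"
    unfolding sum_distrib_left mult.assoc by (rule sum.swap)
  also have "\<dots> = (\<Sum>B\<in>Pow I. (\<Sum>k=1..m. (-1) ^ (k+1) * real (card B choose k)) * \<sigma> B)"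
    by (simp add: sum_distrib_right)
  also have "\<dots> = (\<Sum>B\<in>Pow I - {{}}. (\<Sum>k=1..m. (-1) ^ (k+1) * real (card B choose k)) * \<sigma> B)"
  proof (rule sum.mono_neutral_right)
    \<comment> \<open>The empty set contributes nothing because the summation starts at k = 1; this
      is what lets the binomial identity, valid for \<open>b \<ge> 1\<close>, be applied to all
      remaining sets.\<close>
    have "(\<Sum>k=1..m. (-1) ^ (k+1) * real (0 choose k)) = 0"
      by (intro sum.neutral) auto
    moreover have "card B = 0" if "B \<in> Pow I - (Pow I - {{}})" for B
      using that by auto
    ultimately show "\<forall>B\<in>Pow I - (Pow I - {{}}). (\<Sum>k=1..m. (-1) ^ (k+1) * real (card B choose k)) * \<sigma> B = 0"
      by (metis mult_zero_left)
  qed (use fin in auto)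
  also have "\<dots> = (\<Sum>B\<in>Pow I - {{}}. \<sigma> B - (-1) ^ m * real ((card B - 1) choose m) * \<sigma> B)"
  proof (rule sum.cong[OF refl])
    fix B assume B: "B \<in> Pow I - {{}}"
    then have "finite B" using fin finite_subset by auto
    then have "card B \<ge> 1" using B by (simp add: Suc_le_eq card_gt_0_iff)
    show "(\<Sum>k=1..m. (-1) ^ (k+1) * real (card B choose k)) * \<sigma> B =
        \<sigma> B - (-1) ^ m * real ((card B - 1) choose m) * \<sigma> B"
      unfolding alternating_binomial_partial_sum[OF \<open>card B \<ge> 1\<close>] by (simp add: algebra_simps)
  qed
  finally show ?thesis .
qed

text \<open>The coefficient is \<open>m choose m\<close>, that is 1, when
  \<open>card B = Suc m\<close>; all other terms on the right are nonnegative.\<close>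

lemma sum_card_eq_le:
  fixes \<sigma> :: "'i set \<Rightarrow> real"
  assumes fin: "finite I" and nonneg: "\<And>B. B \<subseteq> I \<Longrightarrow> 0 \<le> \<sigma> B"
  shows "(\<Sum>B | B \<subseteq> I \<and> card B = Suc m. \<sigma> B) \<le> (\<Sum>B\<in>Pow I - {{}}. real ((card B - 1) choose m) * \<sigma> B)"
proof -
  have "(\<Sum>B | B \<subseteq> I \<and> card B = Suc m. \<sigma> B) =
      (\<Sum>B | B \<subseteq> I \<and> card B = Suc m. real ((card B - 1) choose m) * \<sigma> B)"
    by (intro sum.cong) auto
  also have "\<dots> \<le> (\<Sum>B\<in>Pow I - {{}}. real ((card B - 1) choose m) * \<sigma> B)"
    using fin nonneg by (intro sum_mono2) auto
  finally show ?thesis .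
qed

text \<open>An analogue of the Bonferroni inequalities. For even \<open>m\<close> the partial sum
  misses the full sum by the terms \<open>((card B - 1) choose m) * \<sigma> B\<close>, and these
  dominate the level \<open>card B = Suc m\<close>. For odd \<open>m\<close> the same amount is an
  excess.\<close>

lemma subset_bonferroni_even:
  fixes \<sigma> :: "'i set \<Rightarrow> real"
  assumes fin: "finite I" and nonneg: "\<And>B. B \<subseteq> I \<Longrightarrow> 0 \<le> \<sigma> B" and "even m"
  shows "(\<Sum>k=1..m. (-1) ^ (k+1) * (\<Sum>B\<in>Pow I. real (card B choose k) * \<sigma> B))
    + (\<Sum>B | B \<subseteq> I \<and> card B = Suc m. \<sigma> B) \<le> (\<Sum>B\<in>Pow I - {{}}. \<sigma> B)"
  using sum_card_eq_le[OF fin nonneg, where m=m] assms(3) unfolding alternating_subset_sum[OF fin] by (simp add: sum_subtractf)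

lemma subset_bonferroni_odd:
  fixes \<sigma> :: "'i set \<Rightarrow> real"
  assumes fin: "finite I" and nonneg: "\<And>B. B \<subseteq> I \<Longrightarrow> 0 \<le> \<sigma> B" and "odd m"
  shows "(\<Sum>B\<in>Pow I - {{}}. \<sigma> B) \<le>
    (\<Sum>k=1..m. (-1) ^ (k+1) * (\<Sum>B\<in>Pow I. real (card B choose k) * \<sigma> B))
    - (\<Sum>B | B \<subseteq> I \<and> card B = Suc m. \<sigma> B)"
  using sum_card_eq_le[OF fin nonneg, where m=m] assms(3) unfolding alternating_subset_sum[OF fin] by (simp add: sum.distrib)

section \<open>Words in commuting operators\<close>

text \<open>The first letter of \<open>v\<close> is located in \<open>w\<close> and moved to the
  front by successive commutations. \<open>R\<close> is only a partial equivalence in the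
  application: \<open>R x x\<close> there says that \<open>x\<close> is square-integrable, which is
  when the operators commute.\<close>

lemma foldr_perm:
  assumes trans: "\<And>x y z. R x y \<Longrightarrow> R y z \<Longrightarrow> R x z"
    and refl: "\<And>w. set w \<subseteq> W \<Longrightarrow> R (foldr F w s) (foldr F w s)"
    and cong: "\<And>a x y. a \<in> W \<Longrightarrow> R x y \<Longrightarrow> R (F a x) (F a y)"
    and comm: "\<And>a b x. a \<in> W \<Longrightarrow> b \<in> W \<Longrightarrow> R x x \<Longrightarrow> R (F a (F b x)) (F b (F a x))"
    and "mset v = mset w" "set w \<subseteq> W"
  shows "R (foldr F v s) (foldr F w s)"
  using assms(5,6)
proof (induction v arbitrary: w)
  case Nil
  then show ?case using refl[of "[]"] by simp
next
  case (Cons a v)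
  have "a \<in> set w" using Cons.prems(1) by (metis list.set_intros(1) mset_eq_setD)
  then obtain xs ys where w: "w = xs @ a # ys" by (meson split_list)
  have a: "a \<in> W" "set xs \<subseteq> W" "set ys \<subseteq> W" using Cons.prems(2) w by auto
  have "R (foldr F v s) (foldr F (xs @ ys) s)"
    using Cons.prems w a by (intro Cons.IH) auto
  then have "R (foldr F (a # v) s) (F a (foldr F (xs @ ys) s))"
    using cong a by simp
  \<comment> \<open>Here \<open>a\<close> travels inwards past the letters of \<open>xs\<close>, one
    commutation for each.\<close>
  moreover have "R (F a (foldr F (xs @ ys) s)) (foldr F w s)"
    using \<open>set xs \<subseteq> W\<close> unfolding w
  proof (induction xs)
    case Nil
    then show ?case using refl[of "a # ys"] a by simp
  next
    case (Cons b xs)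
    have "R (F a (F b (foldr F (xs @ ys) s))) (F b (F a (foldr F (xs @ ys) s)))"
      using Cons.prems a by (intro comm refl) auto
    moreover have "R (F b (F a (foldr F (xs @ ys) s))) (F b (foldr F (xs @ a # ys) s))"
      using Cons by (intro cong) auto
    ultimately show ?case using trans by simp
  qed
  ultimately show ?case by (rule trans)
qed

section \<open>Dependence of the operators on laws and coordinates\<close>

text \<open>Only the laws at the listed indices enter the recursion. The list must be nonempty
  because \<open>iter_var\<close> is unspecified at \<open>[]\<close>.\<close>

lemma iter_var_cong:
  assumes "is \<noteq> []" "\<And>i. i \<in> set is \<Longrightarrow> \<mu> i = \<nu> i"
  shows "iter_var \<mu> is g = iter_var \<nu> is g"
  using assms
  by (induction "is" arbitrary: g rule: induct_list012) (auto simp: cond_exp_coord_def)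

lemma cond_exp_coords_cong:
  assumes "\<And>i. i \<in> set is \<Longrightarrow> \<mu> i = \<nu> i"
  shows "cond_exp_coords \<mu> is g = cond_exp_coords \<nu> is g"
  using assms by (induction "is") (auto simp: cond_exp_coords_def cond_exp_coord_def)

text \<open>This allows the laws outside \<open>{1..n}\<close> to be replaced by arbitrary
  probability measures. With \<open>k \<ge> 1\<close> every index set in the sums is nonempty, so
  each iterated variance is given by its equations.\<close>

lemma
  assumes "k \<ge> 1" "\<And>i. i \<in> {1..n} \<Longrightarrow> \<mu> i = \<nu> i"
  shows J_stat_cong: "J_stat \<mu> n S k = J_stat \<nu> n S k"
    and K_stat_cong: "K_stat \<mu> n S k = K_stat \<nu> n S k"
proof -
  have fin: "finite A" if "A \<subseteq> {1..n}" for A :: "nat set"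
    using that by (rule finite_subset) simp
  have "iter_var \<mu> (sorted_list_of_set A) g = iter_var \<nu> (sorted_list_of_set A) g"
    if "A \<subseteq> {1..n}" "card A = k" for A g
    using that assms fin[OF that(1)] by (intro iter_var_cong) auto
  moreover have "cond_exp_coords \<mu> (sorted_list_of_set A) g = cond_exp_coords \<nu> (sorted_list_of_set A) g"
    if "A \<subseteq> {1..n}" for A g
    using that assms fin[OF that] by (intro cond_exp_coords_cong) auto
  ultimately show "J_stat \<mu> n S k = J_stat \<nu> n S k" "K_stat \<mu> n S k = K_stat \<nu> n S k"
    unfolding J_stat_def K_stat_def by (simp_all cong: conj_cong)
qed

text \<open>Each listed coordinate is overwritten by an integration variable before \<open>g\<close>
  is evaluated.\<close>

lemma cond_exp_coords_invariant:
  assumes "\<And>i. i \<notin> set is \<Longrightarrow> x i = y i"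
  shows "cond_exp_coords \<mu> is g x = cond_exp_coords \<mu> is g y"
  using assms
proof (induction "is" arbitrary: x y)
  case Nil
  then have "x = y" by auto
  then show ?case by simp
next
  case (Cons i "is")
  have "cond_exp_coords \<mu> is g (x(i := t)) = cond_exp_coords \<mu> is g (y(i := t))" for t
    using Cons.prems by (intro Cons.IH) auto
  then show ?case by (simp add: cond_exp_coords_def cond_exp_coord_def)
qed

section \<open>Integrating out one coordinate\<close>

locale coord_product = finite_product_prob_space M I
  for M :: "nat \<Rightarrow> real measure" and I :: "nat set"
begin

abbreviation "P \<equiv> Pi\<^sub>M I M"
abbreviation "E \<equiv> cond_exp_coord M"

lemma measurable_upd:
  assumes "i \<in> I"
  shows "(\<lambda>(x, t). x(i := t)) \<in> P \<Otimes>\<^sub>M M i \<rightarrow>\<^sub>M P"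
  unfolding case_prod_beta'
  by (rule measurable_fun_upd[where J=I]) (use assms in auto)

lemma measurable_upd_comp:
  assumes "i \<in> I" "g \<in> P \<rightarrow>\<^sub>M N"
  shows "(\<lambda>(x, t). g (x(i := t))) \<in> P \<Otimes>\<^sub>M M i \<rightarrow>\<^sub>M N"
  using measurable_compose[OF measurable_upd[OF assms(1)] assms(2)] by (simp add: case_prod_beta')

lemma nn_integral_upd:
  assumes i: "i \<in> I" and g: "g \<in> borel_measurable P"
  shows "(\<integral>\<^sup>+x. (\<integral>\<^sup>+t. g (x(i := t)) \<partial>M i) \<partial>P) = (\<integral>\<^sup>+x. g x \<partial>P)"
proof -
  define J where "J = I - {i}"
  have J: "I = insert i J" "i \<notin> J" "finite J"
    using i finite_index by (auto simp: J_def)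
  have "(\<lambda>x. \<integral>\<^sup>+t. g (x(i := t)) \<partial>M i) \<in> borel_measurable P"
    using sigma_finite_measure.borel_measurable_nn_integral_fst[OF sigma_finite_measures measurable_upd_comp[OF i g]]
    by simp
  then have "(\<integral>\<^sup>+x. (\<integral>\<^sup>+t. g (x(i := t)) \<partial>M i) \<partial>P)
      = (\<integral>\<^sup>+x. (\<integral>\<^sup>+y. (\<integral>\<^sup>+t. g ((x(i := y))(i := t)) \<partial>M i) \<partial>M i) \<partial>Pi\<^sub>M J M)"
    unfolding J(1) by (intro product_nn_integral_insert J)
  \<comment> \<open>The second update at \<open>i\<close> overwrites the first, so the integrand is
    constant in \<open>y\<close> and integrates to itself against a probability measure.\<close>
  also have "\<dots> = (\<integral>\<^sup>+x. (\<integral>\<^sup>+t. g (x(i := t)) \<partial>M i) \<partial>Pi\<^sub>M J M)"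
    by (simp add: M.emeasure_space_1)
  also have "\<dots> = (\<integral>\<^sup>+x. g x \<partial>P)"
    using g unfolding J(1) by (intro product_nn_integral_insert[symmetric] J)
  finally show ?thesis .
qed

text \<open>Resampling one coordinate independently from its own law preserves the product law. The
  measure-theoretic facts about \<open>E i\<close> are pulled back along this map.\<close>

lemma distr_upd:
  assumes i: "i \<in> I"
  shows "distr (P \<Otimes>\<^sub>M M i) P (\<lambda>(x, t). x(i := t)) = P"
proof (rule measure_eqI)
  fix A assume "A \<in> sets (distr (P \<Otimes>\<^sub>M M i) P (\<lambda>(x, t). x(i := t)))"
  then have A: "A \<in> sets P" by simp
  then have m: "(indicator A :: _ \<Rightarrow> ennreal) \<in> borel_measurable P" by simp
  have "emeasure (distr (P \<Otimes>\<^sub>M M i) P (\<lambda>(x, t). x(i := t))) A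
      = (\<integral>\<^sup>+z. indicator A z \<partial>distr (P \<Otimes>\<^sub>M M i) P (\<lambda>(x, t). x(i := t)))"
    using A by simp
  also have "\<dots> = (\<integral>\<^sup>+z. (case z of (x, t) \<Rightarrow> indicator A (x(i := t))) \<partial>(P \<Otimes>\<^sub>M M i))"
    by (subst nn_integral_distr[OF measurable_upd[OF i]]) (use m in \<open>auto simp: case_prod_beta'\<close>)
  also have "\<dots> = (\<integral>\<^sup>+x. (\<integral>\<^sup>+t. indicator A (x(i := t)) \<partial>M i) \<partial>P)"
    using sigma_finite_measure.nn_integral_fst[OF sigma_finite_measures measurable_upd_comp[OF i m]]
    by simp
  also have "\<dots> = emeasure P A"
    using nn_integral_upd[OF i m] A by simp
  finally show "emeasure (distr (P \<Otimes>\<^sub>M M i) P (\<lambda>(x, t). x(i := t))) A = emeasure P A" .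
qed simp

lemma pair_upd: "pair_sigma_finite P (M i)"
  by (intro pair_sigma_finite.intro sigma_finite_measure_axioms sigma_finite_measures)

lemma AE_upd:
  assumes i: "i \<in> I" and Q: "AE x in P. Q x"
  shows "AE x in P. AE t in M i. Q (x(i := t))"
proof -
  have "AE x in distr (P \<Otimes>\<^sub>M M i) P (\<lambda>(x, t). x(i := t)). Q x"
    unfolding distr_upd[OF i] by (rule Q)
  from AE_distrD[OF measurable_upd[OF i] this]
  have "AE z in P \<Otimes>\<^sub>M M i. Q ((fst z)(i := snd z))"
    by (simp add: case_prod_beta')
  from pair_sigma_finite.AE_pair[OF pair_upd this] show ?thesis by simp
qed

lemma borel_measurable_E:
  assumes i: "i \<in> I" and g: "g \<in> borel_measurable P"
  shows "E i g \<in> borel_measurable P"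
  unfolding cond_exp_coord_def
  by (rule sigma_finite_measure.borel_measurable_lebesgue_integral[OF sigma_finite_measures measurable_upd_comp[OF i g]])

text \<open>Fubini on the product of \<open>P\<close> and \<open>M i\<close>, applied to the
  function with coordinate \<open>i\<close> resampled; \<open>distr_upd\<close> identifies the
  double integral with that of \<open>g\<close>.\<close>

lemma
  fixes g :: "(nat \<Rightarrow> real) \<Rightarrow> real"
  assumes i: "i \<in> I" and g: "integrable P g"
  shows AE_integrable_upd: "AE x in P. integrable (M i) (\<lambda>t. g (x(i := t)))"
    and integrable_E: "integrable P (E i g)"
    and integral_E: "(\<integral>x. E i g x \<partial>P) = (\<integral>x. g x \<partial>P)"
proof -
  interpret U: pair_sigma_finite P "M i" by (rule pair_upd)
  have m: "g \<in> borel_measurable P" using g by simp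
  have int: "integrable (P \<Otimes>\<^sub>M M i) (\<lambda>(x, t). g (x(i := t)))"
    using integrable_distr_eq[OF measurable_upd[OF i] m] g
    unfolding distr_upd[OF i] by (simp add: case_prod_beta')
  show "AE x in P. integrable (M i) (\<lambda>t. g (x(i := t)))"
    using U.AE_integrable_fst'[OF int] by simp
  show "integrable P (E i g)"
    using U.integrable_fst'[OF int] by (simp add: cond_exp_coord_def)
  have "(\<integral>x. E i g x \<partial>P) = (\<integral>z. (case z of (x, t) \<Rightarrow> g (x(i := t))) \<partial>(P \<Otimes>\<^sub>M M i))"
    using U.integral_fst'[OF int] by (simp add: cond_exp_coord_def)
  also have "\<dots> = (\<integral>x. g x \<partial>P)"
    using integral_distr[OF measurable_upd[OF i] m] unfolding distr_upd[OF i]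
    by (simp add: case_prod_beta')
  finally show "(\<integral>x. E i g x \<partial>P) = (\<integral>x. g x \<partial>P)" .
qed

lemma E_cong_AE:
  assumes i: "i \<in> I" and m: "f \<in> borel_measurable P" "g \<in> borel_measurable P"
    and eq: "AE x in P. f x = g x"
  shows "AE x in P. E i f x = E i g x"
  using AE_upd[OF i eq] AE_space
proof eventually_elim
  case (elim x)
  have "(\<lambda>t. h (x(i := t))) \<in> borel_measurable (M i)" if "h \<in> borel_measurable P" for h :: "_ \<Rightarrow> real"
    using measurable_compose[OF measurable_Pair1'[OF elim(2)] measurable_upd_comp[OF i that]] by simp
  then show ?case
    unfolding cond_exp_coord_def using elim m by (intro integral_cong_AE) auto
qed

lemma E_diff_AE:
  assumes i: "i \<in> I" and "integrable P f" "integrable P g"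
  shows "AE x in P. E i (\<lambda>x. f x - g x) x = E i f x - E i g x"
  using AE_integrable_upd[OF i assms(2)] AE_integrable_upd[OF i assms(3)]
  by eventually_elim (simp add: cond_exp_coord_def)

text \<open>By Tonelli, averaging the absolute value over both coordinates preserves its finite
  integral, so almost every section in the coordinates \<open>i\<close> and \<open>j\<close> is
  integrable. Fubini applies to such a section, and the two updates commute for distinct
  indices.\<close>

lemma E_commute_AE:
  assumes i: "i \<in> I" and j: "j \<in> I" and g: "integrable P g"
  shows "AE x in P. E i (E j g) x = E j (E i g) x"
proof (cases "i = j")
  case False
  define h where "h = (\<lambda>x. ennreal (norm (g x)))"
  have m: "g \<in> borel_measurable P" using g by simp
  then have h: "h \<in> borel_measurable P" by (simp add: h_def)
  have hj: "(\<lambda>x. \<integral>\<^sup>+s. h (x(j := s)) \<partial>M j) \<in> borel_measurable P"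
    using sigma_finite_measure.borel_measurable_nn_integral_fst[OF sigma_finite_measures measurable_upd_comp[OF j h]]
    by simp
  have hij: "(\<lambda>x. \<integral>\<^sup>+t. \<integral>\<^sup>+s. h (x(i := t, j := s)) \<partial>M j \<partial>M i) \<in> borel_measurable P"
    using sigma_finite_measure.borel_measurable_nn_integral_fst[OF sigma_finite_measures measurable_upd_comp[OF i hj]]
    by simp
  have "(\<integral>\<^sup>+x. \<integral>\<^sup>+t. \<integral>\<^sup>+s. h (x(i := t, j := s)) \<partial>M j \<partial>M i \<partial>P) = (\<integral>\<^sup>+x. h x \<partial>P)"
    using nn_integral_upd[OF i hj] nn_integral_upd[OF j h] by simp
  also have "\<dots> < \<infinity>"
    using g by (simp add: integrable_iff_bounded h_def)
  finally have "AE x in P. (\<integral>\<^sup>+t. \<integral>\<^sup>+s. h (x(i := t, j := s)) \<partial>M j \<partial>M i) \<noteq> \<infinity>"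
    by (intro nn_integral_PInf_AE[OF hij]) simp
  then show ?thesis
    using AE_space
  proof eventually_elim
    case (elim x)
    interpret pair_sigma_finite "M i" "M j"
      by (intro pair_sigma_finite.intro sigma_finite_measures)
    have u: "(\<lambda>z. x(i := fst z, j := snd z)) \<in> M i \<Otimes>\<^sub>M M j \<rightarrow>\<^sub>M P"
      using elim(2)
      by (intro measurable_fun_upd[where J=I] measurable_const) (use i j in auto)
    have k: "(\<lambda>(t, s). g (x(i := t, j := s))) \<in> borel_measurable (M i \<Otimes>\<^sub>M M j)"
      using measurable_compose[OF u m] by (simp add: case_prod_beta')
    have "integrable (M i \<Otimes>\<^sub>M M j) (\<lambda>(t, s). g (x(i := t, j := s)))"
    proof (rule integrableI_bounded[OF k])
      have "(\<integral>\<^sup>+z. ennreal (norm (case z of (t, s) \<Rightarrow> g (x(i := t, j := s)))) \<partial>(M i \<Otimes>\<^sub>M M j))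
        = (\<integral>\<^sup>+t. \<integral>\<^sup>+s. h (x(i := t, j := s)) \<partial>M j \<partial>M i)"
        using k by (subst sigma_finite_measure.nn_integral_fst[OF sigma_finite_measures, symmetric])
           (auto simp: h_def)
      then show "(\<integral>\<^sup>+z. ennreal (norm (case z of (t, s) \<Rightarrow> g (x(i := t, j := s)))) \<partial>(M i \<Otimes>\<^sub>M M j)) < \<infinity>"
        using elim(1) by (simp add: less_top)
    qed
    from Fubini_integral[OF this] show ?case
      using False by (simp add: cond_exp_coord_def fun_upd_twist)
  qed
qed simp

section \<open>Square-integrable functions\<close>

definition sq_int :: "((nat \<Rightarrow> real) \<Rightarrow> real) \<Rightarrow> bool" where
  "sq_int f \<longleftrightarrow> f \<in> borel_measurable P \<and> integrable P (\<lambda>x. (f x)\<^sup>2)"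

definition D :: "nat \<Rightarrow> ((nat \<Rightarrow> real) \<Rightarrow> real) \<Rightarrow> (nat \<Rightarrow> real) \<Rightarrow> real" where
  "D i f = (\<lambda>x. f x - E i f x)"

definition energy :: "((nat \<Rightarrow> real) \<Rightarrow> real) \<Rightarrow> real" where
  "energy f = (\<integral>x. (f x)\<^sup>2 \<partial>P)"

lemma energy_nonneg: "0 \<le> energy f"
  by (simp add: energy_def)

lemma sq_int_measurable: "sq_int f \<Longrightarrow> f \<in> borel_measurable P"
  by (simp add: sq_int_def)

lemma sq_int_integrable: "sq_int f \<Longrightarrow> integrable P f"
  unfolding sq_int_def by (blast intro: square_integrable_imp_integrable)

lemma sq_int_diff:
  assumes "sq_int f" "sq_int g"
  shows "sq_int (\<lambda>x. f x - g x)"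
  unfolding sq_int_def
proof
  have f: "f \<in> borel_measurable P" "g \<in> borel_measurable P"
    and int: "integrable P (\<lambda>x. (f x)\<^sup>2)" "integrable P (\<lambda>x. (g x)\<^sup>2)"
    using assms by (auto simp: sq_int_def)
  show m: "(\<lambda>x. f x - g x) \<in> borel_measurable P" using f by simp
  show "integrable P (\<lambda>x. (f x - g x)\<^sup>2)"
  proof (rule Bochner_Integration.integrable_bound)
    show "integrable P (\<lambda>x. 2 * (f x)\<^sup>2 + 2 * (g x)\<^sup>2)" using int by simp
    show "AE x in P. norm ((f x - g x)\<^sup>2) \<le> norm (2 * (f x)\<^sup>2 + 2 * (g x)\<^sup>2)"
    proof (rule AE_I2)
      fix x
      \<comment> \<open>The parallelogram identity gives the bound once this square is
        dropped.\<close>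
      have "0 \<le> (f x + g x)\<^sup>2" by simp
      then have "(f x - g x)\<^sup>2 \<le> 2 * (f x)\<^sup>2 + 2 * (g x)\<^sup>2"
        unfolding power2_sum power2_diff by linarith
      then show "norm ((f x - g x)\<^sup>2) \<le> norm (2 * (f x)\<^sup>2 + 2 * (g x)\<^sup>2)"
        by simp
    qed
  qed (use m in simp)
qed

text \<open>For almost every \<open>x\<close>, this is the formula for the variance of \<open>\<lambda>t. f (x(i := t))\<close>.\<close>

lemma coord_variance_AE:
  assumes i: "i \<in> I" and f: "sq_int f"
  shows "AE x in P. E i (\<lambda>x. (D i f x)\<^sup>2) x = E i (\<lambda>x. (f x)\<^sup>2) x - (E i f x)\<^sup>2"
proof -
  have "integrable P (\<lambda>x. (f x)\<^sup>2)" using f by (simp add: sq_int_def)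
  from AE_integrable_upd[OF i sq_int_integrable[OF f]] AE_integrable_upd[OF i this]
  show ?thesis
    by eventually_elim (use M.variance_eq in \<open>simp add: cond_exp_coord_def D_def\<close>)
qed

text \<open>Nonnegativity of the conditional variance bounds \<open>(E i f)\<^sup>2\<close> by
  \<open>E i\<close> of the square of \<open>f\<close>, which is integrable.\<close>

lemma sq_int_E:
  assumes i: "i \<in> I" and f: "sq_int f"
  shows "sq_int (E i f)"
  unfolding sq_int_def
proof
  show m: "E i f \<in> borel_measurable P"
    using i f by (intro borel_measurable_E sq_int_measurable)
  have int: "integrable P (\<lambda>x. (f x)\<^sup>2)" using f by (simp add: sq_int_def)
  show "integrable P (\<lambda>x. (E i f x)\<^sup>2)"
  proof (rule Bochner_Integration.integrable_bound[OF integrable_E[OF i int]])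
    show "AE x in P. norm ((E i f x)\<^sup>2) \<le> norm (E i (\<lambda>x. (f x)\<^sup>2) x)"
      using coord_variance_AE[OF i f]
    proof eventually_elim
      case (elim x)
      moreover have "0 \<le> E i (\<lambda>x. (D i f x)\<^sup>2) x" by (simp add: cond_exp_coord_def)
      ultimately show ?case by simp
    qed
  qed (use m in simp)
qed

lemma sq_int_D: "i \<in> I \<Longrightarrow> sq_int f \<Longrightarrow> sq_int (D i f)"
  unfolding D_def by (intro sq_int_diff sq_int_E)

text \<open>Pythagoras for the orthogonal projection \<open>E i\<close>, obtained by integrating the
  conditional variance formula, since \<open>E i\<close> preserves integrals.\<close>

lemma energy_D:
  assumes i: "i \<in> I" and f: "sq_int f"
  shows "energy (D i f) = energy f - energy (E i f)"
proof -
  have int: "integrable P (\<lambda>x. (g x)\<^sup>2)" "(\<lambda>x. (g x)\<^sup>2) \<in> borel_measurable P" if "sq_int g" for g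
    using that by (auto simp: sq_int_def)
  note D = int[OF sq_int_D[OF i f]] and Ef = int[OF sq_int_E[OF i f]] and f' = int[OF f]
  have "energy (D i f) = (\<integral>x. E i (\<lambda>x. (D i f x)\<^sup>2) x \<partial>P)"
    unfolding energy_def by (rule integral_E[OF i D(1), symmetric])
  also have "\<dots> = (\<integral>x. E i (\<lambda>x. (f x)\<^sup>2) x - (E i f x)\<^sup>2 \<partial>P)"
    by (intro integral_cong_AE coord_variance_AE[OF i f] borel_measurable_diff
        borel_measurable_E[OF i] D Ef f')
  also have "\<dots> = energy f - energy (E i f)"
    using integrable_E[OF i f'(1)] Ef integral_E[OF i f'(1)] by (simp add: energy_def)
  finally show ?thesis .
qed

text \<open>Equality in the space of square-integrable functions, without passing to quotients.
  Square-integrability is built in so that it accompanies every chain of equalities.\<close>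

definition L2_eq :: "((nat \<Rightarrow> real) \<Rightarrow> real) \<Rightarrow> ((nat \<Rightarrow> real) \<Rightarrow> real) \<Rightarrow> bool" where
  "L2_eq f g \<longleftrightarrow> sq_int f \<and> sq_int g \<and> (AE x in P. f x = g x)"

lemma L2_eq_refl: "L2_eq f f \<longleftrightarrow> sq_int f"
  by (simp add: L2_eq_def)

lemma L2_eq_sym: "L2_eq f g \<Longrightarrow> L2_eq g f"
  by (auto simp: L2_eq_def)

lemma L2_eq_trans: "L2_eq f g \<Longrightarrow> L2_eq g h \<Longrightarrow> L2_eq f h"
  unfolding L2_eq_def by auto

lemma energy_cong: "L2_eq f g \<Longrightarrow> energy f = energy g"
  unfolding energy_def L2_eq_def sq_int_def by (intro integral_cong_AE) auto

lemma L2_eq_E: "i \<in> I \<Longrightarrow> L2_eq f g \<Longrightarrow> L2_eq (E i f) (E i g)"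
  unfolding L2_eq_def by (blast intro: sq_int_E E_cong_AE sq_int_measurable)

lemma L2_eq_diff:
  "L2_eq f f' \<Longrightarrow> L2_eq g g' \<Longrightarrow> L2_eq (\<lambda>x. f x - g x) (\<lambda>x. f' x - g' x)"
  unfolding L2_eq_def by (auto intro!: sq_int_diff)

lemma L2_eq_D: "i \<in> I \<Longrightarrow> L2_eq f g \<Longrightarrow> L2_eq (D i f) (D i g)"
  unfolding D_def by (intro L2_eq_diff L2_eq_E)

section \<open>Commutation of the operators up to null sets\<close>

lemma E_E_commute: "i \<in> I \<Longrightarrow> j \<in> I \<Longrightarrow> sq_int f \<Longrightarrow> L2_eq (E i (E j f)) (E j (E i f))"
  unfolding L2_eq_def by (intro conjI sq_int_E E_commute_AE sq_int_integrable)

lemma E_diff: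
  "i \<in> I \<Longrightarrow> sq_int f \<Longrightarrow> sq_int g \<Longrightarrow> L2_eq (E i (\<lambda>x. f x - g x)) (\<lambda>x. E i f x - E i g x)"
  unfolding L2_eq_def by (intro conjI sq_int_E sq_int_diff E_diff_AE sq_int_integrable)

lemma E_D_commute:
  assumes "i \<in> I" "j \<in> I" "sq_int f"
  shows "L2_eq (E i (D j f)) (D j (E i f))"
proof -
  have "L2_eq (E i (D j f)) (\<lambda>x. E i f x - E i (E j f) x)"
    unfolding D_def using assms by (intro E_diff sq_int_E)
  moreover have "L2_eq (\<lambda>x. E i f x - E i (E j f) x) (D j (E i f))"
    unfolding D_def using assms by (intro L2_eq_diff E_E_commute) (auto simp: L2_eq_refl sq_int_E)
  ultimately show ?thesis by (rule L2_eq_trans)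
qed

lemma D_D_commute:
  assumes "i \<in> I" "j \<in> I" "sq_int f"
  shows "L2_eq (D i (D j f)) (D j (D i f))"
proof -
  have "L2_eq (\<lambda>x. D j f x - E i (D j f) x) (\<lambda>x. D j f x - D j (E i f) x)"
    using assms by (intro L2_eq_diff E_D_commute) (auto simp: L2_eq_refl sq_int_D)
  \<comment> \<open>Pointwise, the left side regroups as \<open>D i f\<close> minus
    \<open>E j f - E j (E i f)\<close>; linearity of \<open>E j\<close> turns the latter into
    \<open>E j (D i f)\<close>.\<close>
  moreover have "L2_eq (\<lambda>x. D j f x - D j (E i f) x) (\<lambda>x. D i f x - E j (D i f) x)"
  proof -
    have "L2_eq (\<lambda>x. (D i f x) - (E j f x - E j (E i f) x)) (\<lambda>x. D i f x - E j (D i f) x)"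
      unfolding D_def using assms
      by (intro L2_eq_diff L2_eq_sym[OF E_diff]) (auto simp: L2_eq_refl sq_int_E sq_int_diff)
    then show ?thesis by (simp add: D_def algebra_simps)
  qed
  ultimately show ?thesis
    unfolding D_def[of i "D j f"] D_def[of j "D i f"] by (rule L2_eq_trans)
qed

text \<open>A word in the letters \<open>(True, i)\<close> and \<open>(False, i)\<close> encodes a product of the
  operators \<open>D i\<close> and \<open>E i\<close>, which pairwise commute.\<close>

definition letter :: "bool \<times> nat \<Rightarrow> ((nat \<Rightarrow> real) \<Rightarrow> real) \<Rightarrow> (nat \<Rightarrow> real) \<Rightarrow> real" where
  "letter a = (if fst a then D (snd a) else E (snd a))"

lemma letter_simps [simp]: "letter (True, i) = D i" "letter (False, i) = E i"
  by (simp_all add: letter_def)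

lemma sq_int_word:
  assumes "snd ` set w \<subseteq> I" "sq_int f"
  shows "sq_int (foldr letter w f)"
  using assms by (induction w) (auto simp: letter_def intro: sq_int_E sq_int_D)

lemma L2_eq_letter: "snd a \<in> I \<Longrightarrow> L2_eq f g \<Longrightarrow> L2_eq (letter a f) (letter a g)"
  by (simp add: letter_def L2_eq_E L2_eq_D)

lemma letter_commute:
  "snd a \<in> I \<Longrightarrow> snd b \<in> I \<Longrightarrow> sq_int f \<Longrightarrow> L2_eq (letter a (letter b f)) (letter b (letter a f))"
  by (auto simp: letter_def intro: E_E_commute E_D_commute D_D_commute L2_eq_sym[OF E_D_commute])

lemma word_perm:
  assumes "mset v = mset w" "snd ` set w \<subseteq> I" "sq_int f"
  shows "L2_eq (foldr letter v f) (foldr letter w f)"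
proof (rule foldr_perm[where R=L2_eq and F=letter and W="{a. snd a \<in> I}"])
  show "L2_eq f h" if "L2_eq f g" "L2_eq g h" for f g h
    using that by (rule L2_eq_trans)
  show "L2_eq (foldr letter u f) (foldr letter u f)" if "set u \<subseteq> {a. snd a \<in> I}" for u
    using that assms(3) by (auto simp: L2_eq_refl intro!: sq_int_word)
qed (use assms(1,2) in \<open>auto simp: L2_eq_refl L2_eq_letter letter_commute\<close>)

text \<open>By commutation the new letter may be moved to the front, where it acts last, and
  \<open>energy_D\<close> splits the norm of the function it acts on.\<close>

lemma energy_word_split:
  assumes "snd ` set (v @ w) \<subseteq> I" "i \<in> I" "sq_int f"
  shows "energy (foldr letter (v @ w) f) =
    energy (foldr letter (v @ (True, i) # w) f) + energy (foldr letter (v @ (False, i) # w) f)"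
proof -
  have "energy (foldr letter (v @ a # w) f) = energy (letter a (foldr letter (v @ w) f))"
    if "snd a = i" for a
    using energy_cong[OF word_perm[of "v @ a # w" "a # v @ w" f]] assms that by auto
  from this[of "(True, i)"] this[of "(False, i)"] show ?thesis
    using energy_D[of i "foldr letter (v @ w) f"] sq_int_word[of "v @ w" f] assms by simp
qed

text \<open>The recursion for the iterated variance becomes Pythagoras after integration: the
  difference of the energies without and with \<open>E i\<close> is the energy with
  \<open>D i\<close>. Integrability is carried through the induction so that the integral of the
  difference splits.\<close>

lemma iter_var_energy:
  assumes "is \<noteq> []" "set is \<subseteq> I" "sq_int f"
  shows "integrable P (iter_var M is f) \<and>
    (\<integral>x. iter_var M is f x \<partial>P) = energy (foldr letter (map (Pair True) is) f)"
  using assms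
proof (induction "is" arbitrary: f rule: induct_list012)
  case (2 i)
  have "integrable P (\<lambda>x. (D i f x)\<^sup>2)"
    using sq_int_D[of i f] 2 by (simp add: sq_int_def)
  then have "integrable P (E i (\<lambda>x. (D i f x)\<^sup>2)) \<and> (\<integral>x. E i (\<lambda>x. (D i f x)\<^sup>2) x \<partial>P) = energy (D i f)"
    using 2 integrable_E[of i] integral_E[of i] by (simp add: energy_def)
  then show ?case by (simp add: D_def)
next
  case (3 i j js)
  let ?w = "map (Pair True) (j # js)"
  have i: "i \<in> I" and w: "snd ` set ?w \<subseteq> I" using "3.prems" by auto
  have *: "integrable P (iter_var M (j # js) g) \<and>
      (\<integral>x. iter_var M (j # js) g x \<partial>P) = energy (foldr letter ?w g)" if "sq_int g" for g
    using "3.IH"(2)[of g] "3.prems" that by simp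
  note f = *[OF \<open>sq_int f\<close>] and Ef = *[OF sq_int_E[OF i \<open>sq_int f\<close>]]
  have "integrable P (iter_var M (i # j # js) f)"
    using f Ef integrable_E[OF i] by simp
  \<comment> \<open>The outer \<open>E i\<close> of the first term leaves its integral unchanged. In
    the second term \<open>E i\<close> acts on \<open>f\<close> before everything else, so its
    letter stands at the end of the word.\<close>
  moreover have "(\<integral>x. iter_var M (i # j # js) f x \<partial>P)
      = energy (foldr letter ?w f) - energy (foldr letter (?w @ [(False, i)]) f)"
    using f Ef integrable_E[OF i] integral_E[OF i] by simp
  moreover have "\<dots> = energy (foldr letter (?w @ [(True, i)]) f)"
    using energy_word_split[of ?w "[]" i f] w i \<open>sq_int f\<close> by simp
  moreover have "\<dots> = energy (foldr letter (map (Pair True) (i # j # js)) f)"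
    by (intro energy_cong word_perm) (use w i \<open>sq_int f\<close> in auto)
  ultimately show ?case by metis
qed simp

section \<open>Hoeffding components\<close>

text \<open>The letters of \<open>C\<close> come last and hence act first, as in
  \<open>K_stat\<close>, where the conditional expectations are taken inside the iterated
  variance.\<close>

definition word :: "nat set \<Rightarrow> nat set \<Rightarrow> (bool \<times> nat) list" where
  "word A C = map (Pair True) (sorted_list_of_set A) @ map (Pair False) (sorted_list_of_set C)"

text \<open>Coordinates outside \<open>A\<close> and \<open>C\<close> are left free. With none free,
  \<open>mixed f B (I - B)\<close> is the squared norm of the Hoeffding component at
  \<open>B\<close>.\<close>

definition mixed :: "((nat \<Rightarrow> real) \<Rightarrow> real) \<Rightarrow> nat set \<Rightarrow> nat set \<Rightarrow> real" where
  "mixed f A C = energy (foldr letter (word A C) f)"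

lemma foldr_word:
  "foldr letter (word A C) f =
    foldr letter (map (Pair True) (sorted_list_of_set A)) (cond_exp_coords M (sorted_list_of_set C) f)"
  by (simp add: word_def cond_exp_coords_def foldr_map comp_def)

lemma mixed_split:
  assumes AC: "A \<subseteq> I" "C \<subseteq> I" "i \<in> I" "i \<notin> A" "i \<notin> C" and f: "sq_int f"
  shows "mixed f A C = mixed f (insert i A) C + mixed f A (insert i C)"
proof -
  have fin: "finite A" "finite C" using AC finite_index finite_subset by auto
  let ?v = "map (Pair True) (sorted_list_of_set A)" and ?w = "map (Pair False) (sorted_list_of_set C)"
  have m: "mset (sorted_list_of_set B) = mset_set B" for B :: "nat set"
    by (metis mset_sorted_list_of_multiset sorted_list_of_mset_set)
  have I: "snd ` set (?v @ ?w) \<subseteq> I" using AC fin by auto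
  have "energy (foldr letter (?v @ (True, i) # ?w) f) = mixed f (insert i A) C"
    unfolding mixed_def using AC fin f by (intro energy_cong word_perm) (auto simp: word_def m set_insort_key)
  moreover have "energy (foldr letter (?v @ (False, i) # ?w) f) = mixed f A (insert i C)"
    unfolding mixed_def using AC fin f by (intro energy_cong word_perm) (auto simp: word_def m set_insort_key)
  ultimately show ?thesis
    using energy_word_split[OF I \<open>i \<in> I\<close> f] by (simp add: mixed_def word_def)
qed

text \<open>Induction on the set of free coordinates: each one is assigned either to the
  \<open>D\<close> part or to the \<open>E\<close> part, and \<open>B\<close> records the final
  \<open>D\<close> part.\<close>

lemma mixed_eq_sum:
  assumes "A \<subseteq> I" "C \<subseteq> I" "A \<inter> C = {}" and f: "sq_int f"
  shows "mixed f A C = (\<Sum>B | A \<subseteq> B \<and> B \<subseteq> I - C. mixed f B (I - B))"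
proof -
  have "finite (I - (A \<union> C))" using finite_index by simp
  then show ?thesis
    using assms(1-3)
  proof (induction "I - (A \<union> C)" arbitrary: A C rule: finite_induct)
    case empty
    then have C: "C = I - A" "I - C = A" by auto
    then have "{B. A \<subseteq> B \<and> B \<subseteq> I - C} = {A}" by auto
    then show ?case using C by simp
  next
    case (insert i U)
    have i: "i \<in> I" "i \<notin> A" "i \<notin> C" using insert.hyps(4) by auto
    have U: "U = I - (insert i A \<union> C)" "U = I - (A \<union> insert i C)"
      using insert.hyps(2,4) by auto
    have "mixed f A C = mixed f (insert i A) C + mixed f A (insert i C)"
      using i insert.prems f by (intro mixed_split)
    also have "mixed f (insert i A) C = (\<Sum>B | insert i A \<subseteq> B \<and> B \<subseteq> I - C. mixed f B (I - B))"
      by (rule insert.hyps(3)[OF U(1)]) (use i insert.prems in auto)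
    also have "mixed f A (insert i C) = (\<Sum>B | A \<subseteq> B \<and> B \<subseteq> I - insert i C. mixed f B (I - B))"
      by (rule insert.hyps(3)[OF U(2)]) (use i insert.prems in auto)
    \<comment> \<open>The two families are disjoint: the first consists of sets containing
      \<open>i\<close>, the second of sets avoiding it.\<close>
    also have "(\<Sum>B | insert i A \<subseteq> B \<and> B \<subseteq> I - C. mixed f B (I - B))
        + (\<Sum>B | A \<subseteq> B \<and> B \<subseteq> I - insert i C. mixed f B (I - B))
        = (\<Sum>B\<in>{B. insert i A \<subseteq> B \<and> B \<subseteq> I - C} \<union> {B. A \<subseteq> B \<and> B \<subseteq> I - insert i C}. mixed f B (I - B))"
      by (rule sum.union_disjoint[symmetric]) (auto intro: finite_subset[of _ "Pow I"] simp: finite_index)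
    also have "{B. insert i A \<subseteq> B \<and> B \<subseteq> I - C} \<union> {B. A \<subseteq> B \<and> B \<subseteq> I - insert i C}
        = {B. A \<subseteq> B \<and> B \<subseteq> I - C}"
      by auto
    finally show ?case .
  qed
qed

section \<open>Variance and expected statistics in terms of Hoeffding components\<close>

lemma
  assumes A: "A \<subseteq> I" "A \<noteq> {}" and C: "C \<subseteq> I" and f: "sq_int f"
  defines "h \<equiv> iter_var M (sorted_list_of_set A) (cond_exp_coords M (sorted_list_of_set C) f)"
  shows integrable_iter_var: "integrable P h" and integral_iter_var: "(\<integral>x. h x \<partial>P) = mixed f A C"
proof -
  have fin: "finite A" "finite C" using A C finite_index finite_subset by auto
  have "sq_int (foldr letter (word {} C) f)"
    using C fin f by (intro sq_int_word) (auto simp: word_def)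
  then have "sq_int (cond_exp_coords M (sorted_list_of_set C) f)"
    by (simp add: foldr_word)
  with iter_var_energy[OF _ _ this, of "sorted_list_of_set A"]
  show "integrable P h" "(\<integral>x. h x \<partial>P) = mixed f A C"
    using A fin by (simp_all add: h_def mixed_def foldr_word)
qed

lemma mixed_empty_I:
  assumes f: "sq_int f"
  shows "mixed f {} I = (\<integral>x. f x \<partial>P)\<^sup>2"
proof -
  \<comment> \<open>Points of the product space are \<open>undefined\<close> outside
    \<open>I\<close>, so this base point agrees with each of them there; the coordinates in
    \<open>I\<close> are all integrated out.\<close>
  define c where "c = cond_exp_coords M (sorted_list_of_set I) f (\<lambda>i. undefined)"
  have c: "cond_exp_coords M (sorted_list_of_set I) f x = c" if "x \<in> space P" for x
    unfolding c_def using that finite_index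
    by (intro cond_exp_coords_invariant) (auto simp: space_PiM PiE_def extensional_def)
  have "(\<integral>x. foldr E is f x \<partial>P) = (\<integral>x. f x \<partial>P) \<and> integrable P (foldr E is f)"
    if "set is \<subseteq> I" for "is"
    using that by (induction "is") (auto simp: integral_E integrable_E sq_int_integrable[OF f])
  from this[of "sorted_list_of_set I"]
  have "(\<integral>x. f x \<partial>P) = (\<integral>x. cond_exp_coords M (sorted_list_of_set I) f x \<partial>P)"
    using finite_index by (simp add: cond_exp_coords_def)
  also have "\<dots> = (\<integral>x. c \<partial>P)"
    by (rule Bochner_Integration.integral_cong) (auto simp: c)
  also have "\<dots> = c" by (simp add: P.prob_space)
  finally have "(\<integral>x. f x \<partial>P) = c" .
  moreover have "mixed f {} I = (\<integral>x. c\<^sup>2 \<partial>P)"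
    unfolding mixed_def energy_def foldr_word
    by (rule Bochner_Integration.integral_cong) (auto simp: c)
  ultimately show ?thesis by (simp add: P.prob_space)
qed

text \<open>The second moment is the sum over all \<open>B\<close>, and the component at the empty
  set is the squared mean.\<close>

lemma variance_eq_sum_mixed:
  assumes f: "sq_int f"
  shows "variance f = (\<Sum>B\<in>Pow I - {{}}. mixed f B (I - B))"
proof -
  have "variance f = (\<integral>x. (f x)\<^sup>2 \<partial>P) - (\<integral>x. f x \<partial>P)\<^sup>2"
    using f sq_int_integrable[OF f] by (intro variance_eq) (auto simp: sq_int_def)
  also have "(\<integral>x. (f x)\<^sup>2 \<partial>P) = mixed f {} {}"
    by (simp add: mixed_def word_def energy_def)
  also have "\<dots> = (\<Sum>B\<in>Pow I. mixed f B (I - B))"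
    using mixed_eq_sum[OF _ _ _ f, of "{}" "{}"] by (simp add: Pow_def)
  also have "\<dots> = (\<Sum>B\<in>Pow I - {{}}. mixed f B (I - B)) + mixed f {} I"
    using finite_index by (subst sum.remove[of _ "{}"]) auto
  finally show ?thesis using mixed_empty_I[OF f] by simp
qed

text \<open>In \<open>J_stat\<close> the coordinates outside \<open>A\<close> stay free, so every
  superset of \<open>A\<close> contributes. In \<open>K_stat\<close> they are integrated out first,
  and only the component at \<open>A\<close> survives.\<close>

lemma
  assumes I: "I = {1..n}" and k: "k \<ge> 1" and f: "sq_int f"
  shows integrable_J_stat: "integrable P (J_stat M n f k)"
    and integral_J_stat: "(\<integral>x. J_stat M n f k x \<partial>P) =
      fact k * (\<Sum>B\<in>Pow I. real (card B choose k) * mixed f B (I - B))"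
    and integrable_K_stat: "integrable P (K_stat M n f k)"
    and integral_K_stat: "(\<integral>x. K_stat M n f k x \<partial>P) =
      fact k * (\<Sum>B | B \<subseteq> I \<and> card B = k. mixed f B (I - B))"
proof -
  have A: "A \<noteq> {}" if "card A = k" for A :: "nat set" using that k by auto
  have J: "integrable P (iter_var M (sorted_list_of_set A) f)"
    "(\<integral>x. iter_var M (sorted_list_of_set A) f x \<partial>P) = mixed f A {}"
    if "A \<in> {A. A \<subseteq> {1..n} \<and> card A = k}" for A
    using integrable_iter_var[of A "{}" f] integral_iter_var[of A "{}" f] that A[of A] I f
    by (simp_all add: cond_exp_coords_def)
  have K: "integrable P (iter_var M (sorted_list_of_set A) (cond_exp_coords M (sorted_list_of_set ({1..n} - A)) f))"
    "(\<integral>x. iter_var M (sorted_list_of_set A) (cond_exp_coords M (sorted_list_of_set ({1..n} - A)) f) x \<partial>P)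
      = mixed f A (I - A)"
    if "A \<in> {A. A \<subseteq> {1..n} \<and> card A = k}" for A
    using integrable_iter_var[of A "I - A" f] integral_iter_var[of A "I - A" f] that A[of A] I f
    by simp_all
  show "integrable P (J_stat M n f k)" "integrable P (K_stat M n f k)"
    unfolding J_stat_def K_stat_def
    by (intro integrable_mult_right Bochner_Integration.integrable_sum J K; assumption)+
  have "(\<integral>x. J_stat M n f k x \<partial>P) = fact k * (\<Sum>A | A \<subseteq> I \<and> card A = k. mixed f A {})"
    unfolding J_stat_def using J by (simp add: I)
  also have "(\<Sum>A | A \<subseteq> I \<and> card A = k. mixed f A {}) =
      (\<Sum>A | A \<subseteq> I \<and> card A = k. \<Sum>B | A \<subseteq> B \<and> B \<subseteq> I. mixed f B (I - B))"
    using mixed_eq_sum[OF _ _ _ f, of _ "{}"] by (intro sum.cong) auto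
  finally show "(\<integral>x. J_stat M n f k x \<partial>P) =
      fact k * (\<Sum>B\<in>Pow I. real (card B choose k) * mixed f B (I - B))"
    by (simp add: sum_supersets finite_index)
  show "(\<integral>x. K_stat M n f k x \<partial>P) = fact k * (\<Sum>B | B \<subseteq> I \<and> card B = k. mixed f B (I - B))"
    unfolding K_stat_def using K by (simp add: I)
qed

text \<open>The parameter \<open>m\<close> is the last index of the alternating sum: 2p gives the
  lower bound and 2p - 1 the upper one. The factorials cancel, leaving the subset inequalities for
  nonnegative component energies.\<close>

lemma variance_bounds:
  assumes I: "I = {1..n}" and f: "sq_int f"
  defines "s \<equiv> \<lambda>m. \<Sum>k=1..m. (-1) ^ (k+1) / fact k * (\<integral>x. J_stat M n f k x \<partial>P)"
    and "r \<equiv> \<lambda>m. 1 / fact (Suc m) * (\<integral>x. K_stat M n f (Suc m) x \<partial>P)"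
  shows "even m \<Longrightarrow> s m + r m \<le> variance f"
    and "odd m \<Longrightarrow> variance f \<le> s m - r m"
proof -
  have pos: "0 \<le> mixed f B (I - B)" for B by (simp add: mixed_def energy_nonneg)
  have s: "s m = (\<Sum>k=1..m. (-1) ^ (k+1) * (\<Sum>B\<in>Pow I. real (card B choose k) * mixed f B (I - B)))"
    unfolding s_def by (intro sum.cong) (auto simp: integral_J_stat[OF I _ f])
  have r: "r m = (\<Sum>B | B \<subseteq> I \<and> card B = Suc m. mixed f B (I - B))"
    unfolding r_def by (simp add: integral_K_stat[OF I _ f])
  show "s m + r m \<le> variance f" if "even m"
    unfolding s r variance_eq_sum_mixed[OF f]
    by (rule subset_bonferroni_even[OF finite_index pos that])
  show "variance f \<le> s m - r m" if "odd m"
    unfolding s r variance_eq_sum_mixed[OF f]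
    by (rule subset_bonferroni_odd[OF finite_index pos that])
qed

end

section \<open>Transfer from the product space to the random variables\<close>

theorem theorem2p3:
  fixes M :: "'a measure"
    and X :: "nat \<Rightarrow> 'a \<Rightarrow> real"
    and S :: "(nat \<Rightarrow> real) \<Rightarrow> real"
    and n p :: nat
  defines "\<mu> \<equiv> \<lambda>i. distr M borel (X i)"
    and "V \<equiv> \<lambda>\<omega>. \<lambda>i\<in>{1..n}. X i \<omega>"
  assumes "prob_space M"
    and "n \<ge> 1"
    and "prob_space.indep_vars M (\<lambda>_. borel) X {1..n}"
    and "S \<in> borel_measurable (Pi\<^sub>M {1..n} (\<lambda>_. borel))"
    and "integrable M (\<lambda>\<omega>. (S (V \<omega>))\<^sup>2)"
    and "p \<in> {1..n div 2}"
  shows "(\<Sum>k=1..2*p. (-1) ^ (k+1) / fact k * prob_space.expectation M (\<lambda>\<omega>. J_stat \<mu> n S k (V \<omega>)))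
           + 1 / fact (2*p+1) * prob_space.expectation M (\<lambda>\<omega>. K_stat \<mu> n S (2*p+1) (V \<omega>))
         \<le> prob_space.variance M (\<lambda>\<omega>. S (V \<omega>))
       \<and> prob_space.variance M (\<lambda>\<omega>. S (V \<omega>))
         \<le> (\<Sum>k=1..2*p-1. (-1) ^ (k+1) / fact k * prob_space.expectation M (\<lambda>\<omega>. J_stat \<mu> n S k (V \<omega>)))
           - 1 / fact (2*p) * prob_space.expectation M (\<lambda>\<omega>. K_stat \<mu> n S (2*p) (V \<omega>))"
proof -
  interpret prob_space M by fact
  let ?B = "\<lambda>I. Pi\<^sub>M I (\<lambda>_. borel) :: (nat \<Rightarrow> real) measure"
  \<comment> \<open>The locale needs a probability measure at every index, but outside \<open>{1..n}\<close> the function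
    \<open>X i\<close> need not be measurable.\<close>
  define N where "N = (\<lambda>i. if i \<in> {1..n} then \<mu> i else return borel 0)"
  have X[measurable]: "X i \<in> borel_measurable M" if "i \<in> {1..n}" for i
    using assms(5) that unfolding indep_vars_def by auto
  have N: "prob_space (N i)" "sets (N i) = sets borel" for i
    by (auto simp: N_def \<mu>_def intro!: prob_space_distr prob_space_return)
  interpret PP: product_prob_space N "{1..n}"
    by (rule product_prob_spaceI) (rule N)
  interpret Q: coord_product N "{1..n}"
    by unfold_locales simp
  have sets_N: "sets (Pi\<^sub>M {1..n} N) = sets (?B {1..n})"
    by (intro sets_PiM_cong) (auto simp: N)
  have V: "V \<in> M \<rightarrow>\<^sub>M ?B {1..n}"
    unfolding V_def by measurable
  \<comment> \<open>Independence enters here: the joint law is the product of the marginal laws, so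
    expectations become integrals over the product space.\<close>
  have "distr M (?B {1..n}) V = Pi\<^sub>M {1..n} \<mu>"
    unfolding V_def \<mu>_def
    by (rule indep_vars_iff_distr_eq_PiM'[THEN iffD1]) (use assms(4,5) in auto)
  also have "\<dots> = Pi\<^sub>M {1..n} N"
    by (intro PiM_cong) (auto simp: N_def)
  finally have dV: "distr M (?B {1..n}) V = Q.P" .
  have mN: "h \<in> borel_measurable Q.P \<longleftrightarrow> h \<in> borel_measurable (?B {1..n})" for h :: "_ \<Rightarrow> real"
    by (rule arg_cong[where f="\<lambda>A. h \<in> A"], rule measurable_cong_sets[OF sets_N refl])
  have ex: "expectation (\<lambda>\<omega>. h (V \<omega>)) = (\<integral>x. h x \<partial>Q.P)" if "h \<in> borel_measurable Q.P"
    for h :: "_ \<Rightarrow> real"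
    using integral_distr[OF V, of h] that unfolding mN dV by simp
  have S: "S \<in> borel_measurable Q.P" using assms(6) mN by simp
  have sq: "Q.sq_int S"
    unfolding Q.sq_int_def
  proof
    show "integrable Q.P (\<lambda>x. (S x)\<^sup>2)"
      using integrable_distr_eq[OF V, of "\<lambda>x. (S x)\<^sup>2"] assms(6,7) unfolding dV by simp
  qed (rule S)
  have J: "expectation (\<lambda>\<omega>. J_stat \<mu> n S k (V \<omega>)) = (\<integral>x. J_stat N n S k x \<partial>Q.P)"
    and K: "expectation (\<lambda>\<omega>. K_stat \<mu> n S k (V \<omega>)) = (\<integral>x. K_stat N n S k x \<partial>Q.P)"
    if "k \<ge> 1" for k
  proof -
    have "J_stat \<mu> n S k = J_stat N n S k" "K_stat \<mu> n S k = K_stat N n S k"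
      using that by (intro J_stat_cong K_stat_cong; simp add: N_def)+
    then show "expectation (\<lambda>\<omega>. J_stat \<mu> n S k (V \<omega>)) = (\<integral>x. J_stat N n S k x \<partial>Q.P)"
      "expectation (\<lambda>\<omega>. K_stat \<mu> n S k (V \<omega>)) = (\<integral>x. K_stat N n S k x \<partial>Q.P)"
      using ex[OF borel_measurable_integrable[OF Q.integrable_J_stat[OF refl that sq]]]
        ex[OF borel_measurable_integrable[OF Q.integrable_K_stat[OF refl that sq]]]
      by simp_all
  qed
  have s: "(\<Sum>k=1..m. (-1) ^ (k+1) / fact k * expectation (\<lambda>\<omega>. J_stat \<mu> n S k (V \<omega>))) =
      (\<Sum>k=1..m. (-1) ^ (k+1) / fact k * (\<integral>x. J_stat N n S k x \<partial>Q.P))" for m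
    by (intro sum.cong) (auto simp: J)
  have var: "variance (\<lambda>\<omega>. S (V \<omega>)) = prob_space.variance Q.P S"
    using ex[OF S] ex[of "\<lambda>x. (S x - c)\<^sup>2" for c] S by simp
  \<comment> \<open>Since p is at least 1, the natural-number subtraction in
    \<open>2 * p - 1\<close> is not truncated, so this index is odd with successor
    \<open>2 * p\<close>.\<close>
  have p: "2 * p + 1 \<ge> 1" "2 * p \<ge> 1" "even (2 * p)" "odd (2 * p - 1)" "Suc (2 * p) = 2 * p + 1"
    "Suc (2 * p - 1) = 2 * p"
    using assms(8) by auto
  show ?thesis
    unfolding s var K[OF p(1)] K[OF p(2)]
    using Q.variance_bounds(1)[OF refl sq p(3), unfolded p(5)]
      Q.variance_bounds(2)[OF refl sq p(4), unfolded p(6)]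
    by blast
qed

end
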